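(* For all $n\geq 1$, $c_n(1\text{-}22)=M_n$ and $c_n(2\text{-}31)=L_n$.
   Context: A Catalan word of length $n\ge 1$ is a sequence $\pi=\pi_1\cdots\pi_n$ of positive integers with $\pi_1=1$ and $\pi_{i+1}\le \pi_i+1$ for $1\le i\le n-1$; $\mathcal{C}_n$ is the set of these. Two sequences of the same length are order-isomorphic if their corresponding pairs of entries stand in the same relation ($<$, $>$ or $=$). A word $\pi$ contains the vincular pattern $x\text{-}yz$ if there are indices $i<j$ with $j+1\le n$ such that $\pi_i\pi_j\pi_{j+1}$ is order-isomorphic to $xyz$ (the last two letters must be adjacent in $\pi$); otherwise $\pi$ avoids it. $c_n(\tau)$ denotes the number of members of $\mathcal{C}_n$ avoiding $\tau$. Let $u=(1,1)$, $d=(1,-1)$, $h=(1,0)$. $M_n$ is the $n$-th Motzkin number: the number of lattice paths from $(0,0)$ to $(n,0)$ using $u,d,h$ steps that never go below the $x$-axis. $L_n$ (OEIS A005773; $L_1=1$, $L_2=2$, $L_3=5$, $L_4=13,\ldots$) is, for $n\ge 1$, the number of lattice paths from $(0,0)$ to the line $x=n-1$ using $u,d,h$ steps that never go below the $x$-axis (Motzkin left-factors with $n-1$ steps). *)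

theory Defs
  imports Main "HOL-Library.Product_Plus"
begin

text \<open>Words are lists of naturals; list positions are 0-based, so \<open>w ! i\<close> is the
  letter \<open>w\<^sub>i\<^sub>+\<^sub>1\<close> of the paper.\<close>

definition catalan_words :: "nat \<Rightarrow> nat list set" where
  "catalan_words n = {w. length w = n \<and> n \<ge> 1 \<and> (\<forall>a \<in> set w. a \<ge> 1) \<and> w ! 0 = 1 \<and>
     (\<forall>i. i + 1 < n \<longrightarrow> w ! (i + 1) \<le> w ! i + 1)}"

definition order_isomorphic :: "nat list \<Rightarrow> nat list \<Rightarrow> bool" where
  "order_isomorphic v w \<longleftrightarrow> length v = length w \<and>
     (\<forall>i < length v. \<forall>j < length v.
        (v ! i < v ! j \<longleftrightarrow> w ! i < w ! j) \<and>
        (v ! i > v ! j \<longleftrightarrow> w ! i > w ! j) \<and>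
        (v ! i = v ! j \<longleftrightarrow> w ! i = w ! j))"

text \<open>The triple \<open>(x, y, z)\<close> stands for the vincular pattern \<open>x-yz\<close>.\<close>

definition contains_vincular :: "nat list \<Rightarrow> nat \<times> nat \<times> nat \<Rightarrow> bool" where
  "contains_vincular w \<tau> \<longleftrightarrow> (case \<tau> of (x, y, z) \<Rightarrow>
     \<exists>i j. i < j \<and> j + 1 < length w \<and> order_isomorphic [w ! i, w ! j, w ! (j + 1)] [x, y, z])"

definition catalan_avoiders :: "nat \<Rightarrow> nat \<times> nat \<times> nat \<Rightarrow> nat" where
  "catalan_avoiders n \<tau> = card {w \<in> catalan_words n. \<not> contains_vincular w \<tau>}"

definition step_u :: "int \<times> int" where "step_u = (1, 1)"
definition step_d :: "int \<times> int" where "step_d = (1, -1)"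
definition step_h :: "int \<times> int" where "step_h = (1, 0)"

text \<open>A lattice path starting at the origin is represented by its list of steps; the point
  reached after the first \<open>k\<close> steps is the vector sum of these steps.\<close>

definition path_point :: "(int \<times> int) list \<Rightarrow> nat \<Rightarrow> int \<times> int" where
  "path_point p k = sum_list (take k p)"

definition path_end :: "(int \<times> int) list \<Rightarrow> int \<times> int" where
  "path_end p = path_point p (length p)"

definition nonneg_motzkin_paths :: "(int \<times> int) list set" where
  "nonneg_motzkin_paths = {p. set p \<subseteq> {step_u, step_d, step_h} \<and>
     (\<forall>k \<le> length p. snd (path_point p k) \<ge> 0)}"

definition motzkin_number :: "nat \<Rightarrow> nat" where
  "motzkin_number n = card {p \<in> nonneg_motzkin_paths. path_end p = (int n, 0)}"

text \<open>Meaningful for \<open>n \<ge> 1\<close>; the subtraction is on the integers, so there is no truncation.\<close>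

definition motzkin_left_factor_number :: "nat \<Rightarrow> nat" where
  "motzkin_left_factor_number n = card {p \<in> nonneg_motzkin_paths. fst (path_end p) = int n - 1}"

end

theory Submission
  imports Defs
begin

text \<open>
  A Catalan word starts with its least letter \<open>1\<close> and, since it climbs by at most one at each
  place, every letter below a given one has already occurred before it.  Both pattern conditions
  therefore become conditions on adjacent letters.  An occurrence of 1-22 amounts to a level
  \<open>b b\<close> with \<open>b > 1\<close>, the initial letter serving as the small one (\<open>contains_122_iff\<close>).  An
  occurrence of 2-31 amounts to a descent by at least two, the letter just below the top of the
  descent serving as the middle one (\<open>contains_231_iff\<close>).

  Hence a word avoiding 2-31 moves by \<open>+1\<close>, \<open>0\<close> or \<open>-1\<close> and stays at or above its initial
  letter \<open>1\<close>: with heights counted from that letter it is a Motzkin left factor with \<open>n - 1\<close>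
  steps (\<open>card_continuations_slow_step\<close>).

  For 1-22, let \<open>f k m\<close> be the number of ways to continue by \<open>m\<close> letters a word that avoids 1-22
  and currently ends in \<open>k + 1\<close>, and let \<open>g j m\<close> be the number of nonnegative paths with \<open>m\<close>
  Motzkin steps that lead from height \<open>j\<close> to height \<open>0\<close>.  Reading off the next letter gives
  \<open>f 0 (m + 1) = f 0 m + f 1 m\<close> and, for \<open>k \<ge> 1\<close>,
  \<open>f k (m + 1) = f (k + 1) m + f (k - 1) m + \<dots> + f 0 m\<close>; a word falls in one step to any lower
  height, whereas a path descends only by one.  The two counts are reconciled by
  \<open>f 0 m = g 0 (m + 1)\<close> and \<open>f (k + 1) m = (\<Sum>i\<le>k. (k choose i) * g (1 + i) (m + 1))\<close>, proved
  simultaneously by induction on \<open>m\<close> (\<open>card_continuations_no_high_level_step\<close>).  The induction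
  works because the binomial sums are linear, so that they inherit the three-term recurrence of
  \<open>g\<close>, and because Pascal's rule makes the sum over all lower heights telescope to a single
  binomial sum.  The first identity with \<open>m = n - 1\<close> is the claim.
\<close>

section \<open>Counting words letter by letter\<close>

lemma card_UN_Cons:
  assumes "finite B" "\<And>b. b \<in> B \<Longrightarrow> finite (Y b)"
  shows "finite (\<Union>b\<in>B. Cons b ` Y b)"
    and "card (\<Union>b\<in>B. Cons b ` Y b) = (\<Sum>b\<in>B. card (Y b))"
proof -
  show "finite (\<Union>b\<in>B. Cons b ` Y b)"
    using assms by blast
  have "card (\<Union>b\<in>B. Cons b ` Y b) = (\<Sum>b\<in>B. card (Cons b ` Y b))"
    by (rule card_UN_disjoint) (use assms in auto)
  then show "card (\<Union>b\<in>B. Cons b ` Y b) = (\<Sum>b\<in>B. card (Y b))"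
    by (simp add: card_image)
qed

text \<open>The letter \<open>a\<close> already written is kept outside the list: the lists are what may follow it.\<close>

definition continuations :: "('a \<Rightarrow> 'a \<Rightarrow> bool) \<Rightarrow> 'a \<Rightarrow> nat \<Rightarrow> 'a list set" where
  "continuations R a m = {v. length v = m \<and> successively R (a # v)}"

lemma continuations_0: "continuations R a 0 = {[]}"
  by (auto simp: continuations_def)

lemma continuations_Suc:
  "continuations R a (Suc m) = (\<Union>b\<in>{b. R a b}. Cons b ` continuations R b m)"
  by (auto simp: continuations_def length_Suc_conv)

lemma finite_continuations:
  assumes "\<And>a. finite {b. R a b}"
  shows "finite (continuations R a m)"
proof (induction m arbitrary: a)
  case 0
  show ?case by (simp add: continuations_0)
next
  case (Suc m)
  show ?case
    unfolding continuations_Suc by (rule card_UN_Cons(1)) (use assms Suc in auto)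
qed

lemma card_continuations_Suc:
  assumes "\<And>a. finite {b. R a b}"
  shows "card (continuations R a (Suc m)) = (\<Sum>b\<in>{b. R a b}. card (continuations R b m))"
  unfolding continuations_Suc
  by (rule card_UN_Cons(2)) (use assms finite_continuations[of R] in auto)

section \<open>Pattern avoidance as a condition on adjacent letters\<close>

definition catalan_step :: "nat \<Rightarrow> nat \<Rightarrow> bool" where
  "catalan_step a b \<longleftrightarrow> 1 \<le> b \<and> b \<le> a + 1"

lemma catalan_words_eq_continuations:
  assumes "n \<ge> 1"
  shows "catalan_words n = Cons 1 ` continuations catalan_step 1 (n - 1)"
proof -
  have "w \<in> catalan_words n \<longleftrightarrow> w \<in> Cons 1 ` continuations catalan_step 1 (n - 1)" for w
  proof (cases w)
    case Nil
    then show ?thesis using assms by (auto simp: catalan_words_def)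
  next
    case (Cons a v)
    have "(\<forall>x\<in>set v. x \<ge> 1) \<longleftrightarrow> (\<forall>i<length v. w ! Suc i \<ge> 1)"
      by (simp add: Cons all_set_conv_all_nth)
    then show ?thesis
      using assms by (auto simp: Cons catalan_words_def continuations_def catalan_step_def
          successively_conv_nth image_iff)
  qed
  then show ?thesis by blast
qed

text \<open>Climbing by at most one, a word that starts at \<open>1\<close> cannot skip a letter on its way up.\<close>

lemma smaller_letter_occurs_before:
  assumes "w \<in> catalan_words n" "j < n" "1 \<le> c" "c \<le> w ! j"
  shows "\<exists>i\<le>j. w ! i = c"
  using assms(2,4)
proof (induction j)
  case 0
  then show ?case using assms(1,3) by (auto simp: catalan_words_def)
next
  case (Suc j)
  have "w ! Suc j \<le> w ! j + 1"
    using assms(1) Suc.prems(1) by (simp add: catalan_words_def)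
  show ?case
  proof (cases "c \<le> w ! j")
    case True
    then show ?thesis using Suc by (auto intro: le_SucI)
  next
    case False
    then have "w ! Suc j = c" using Suc.prems \<open>w ! Suc j \<le> w ! j + 1\<close> by linarith
    then show ?thesis by blast
  qed
qed

lemma order_isomorphic_122: "order_isomorphic [a, b, c] [1, 2, 2] \<longleftrightarrow> a < b \<and> b = c"
  by (auto simp: order_isomorphic_def All_less_Suc numeral_eq_Suc)

lemma order_isomorphic_231: "order_isomorphic [a, b, c] [2, 3, 1] \<longleftrightarrow> c < a \<and> a < b"
  by (auto simp: order_isomorphic_def All_less_Suc numeral_eq_Suc)

text \<open>Any letter smaller than the repeated one forces the latter to exceed \<open>1\<close>; conversely the
  initial \<open>1\<close> is such a smaller letter.\<close>

lemma contains_122_iff: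
  assumes "w \<in> catalan_words n"
  shows "contains_vincular w (1, 2, 2) \<longleftrightarrow> (\<exists>j. j + 1 < n \<and> w ! j = w ! (j + 1) \<and> w ! j > 1)"
    (is "?L \<longleftrightarrow> ?R")
proof
  assume ?L
  then obtain i j where ij: "i < j" "j + 1 < length w" "w ! i < w ! j" "w ! j = w ! (j + 1)"
    unfolding contains_vincular_def prod.case order_isomorphic_122 by metis
  have "w ! i \<in> set w" using ij by simp
  then have "w ! i \<ge> 1" using assms by (auto simp: catalan_words_def)
  then have "w ! j > 1" using ij by linarith
  then show ?R using ij assms by (auto simp: catalan_words_def)
next
  assume ?R
  then obtain j where j: "j + 1 < n" "w ! j = w ! (j + 1)" "w ! j > 1" by blast
  have w: "w ! 0 = 1" "length w = n" using assms by (auto simp: catalan_words_def)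
  have "0 < j" using j w by (cases j) auto
  then show ?L
    unfolding contains_vincular_def prod.case order_isomorphic_122 using j w by metis
qed

text \<open>The middle letter of the pattern lies strictly between the two ends of the descent, which
  needs a gap of two; conversely, one less than the top of a large descent must have occurred
  before the top.\<close>

lemma contains_231_iff:
  assumes "w \<in> catalan_words n"
  shows "contains_vincular w (2, 3, 1) \<longleftrightarrow> (\<exists>j. j + 1 < n \<and> w ! (j + 1) + 1 < w ! j)"
    (is "?L \<longleftrightarrow> ?R")
proof
  assume ?L
  then obtain i j where ij: "i < j" "j + 1 < length w" "w ! (j + 1) < w ! i" "w ! i < w ! j"
    unfolding contains_vincular_def prod.case order_isomorphic_231 by blast
  then have "w ! (j + 1) + 1 < w ! j" by linarith
  then show ?R using ij assms by (auto simp: catalan_words_def)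
next
  assume ?R
  then obtain j where j: "j + 1 < n" "w ! (j + 1) + 1 < w ! j" by blast
  then have "j < n" "1 \<le> w ! j - 1" "w ! j - 1 \<le> w ! j" by linarith+
  then obtain i where i: "i \<le> j" "w ! i = w ! j - 1"
    using smaller_letter_occurs_before[OF assms] by blast
  then have "i < j" using j by (cases "i = j") auto
  moreover have "w ! (j + 1) < w ! i" "w ! i < w ! j" using i j by linarith+
  moreover have "length w = n" using assms by (auto simp: catalan_words_def)
  ultimately show ?L
    unfolding contains_vincular_def prod.case order_isomorphic_231 using j by metis
qed

lemma catalan_avoiders_eq_card_continuations:
  assumes "n \<ge> 1"
    and avoid: "\<And>w. w \<in> catalan_words n \<Longrightarrow>
      \<not> contains_vincular w \<tau> \<longleftrightarrow> (\<forall>j. j + 1 < n \<longrightarrow> Q (w ! j) (w ! (j + 1)))"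
  shows "catalan_avoiders n \<tau> =
    card (continuations (\<lambda>a b. catalan_step a b \<and> Q a b) 1 (n - 1))"
proof -
  have "{w \<in> catalan_words n. \<not> contains_vincular w \<tau>} =
      {w \<in> catalan_words n. \<forall>j. j + 1 < n \<longrightarrow> Q (w ! j) (w ! (j + 1))}"
    using avoid by blast
  also have "\<dots> = Cons 1 ` continuations (\<lambda>a b. catalan_step a b \<and> Q a b) 1 (n - 1)"
    unfolding catalan_words_eq_continuations[OF assms(1)]
    using assms(1) by (fastforce simp: continuations_def successively_conv_nth image_iff)
  finally show ?thesis
    unfolding catalan_avoiders_def by (simp add: card_image)
qed

section \<open>Motzkin paths\<close>

text \<open>Arbitrary starting heights are what recursion on the first step requires.  The set \<open>T\<close> of
  permitted final heights covers both families of paths: \<open>{0}\<close> for Motzkin paths and \<open>UNIV\<close> for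
  left factors.\<close>

definition motzkin_paths_from :: "nat \<Rightarrow> int set \<Rightarrow> nat \<Rightarrow> (int \<times> int) list set" where
  "motzkin_paths_from k T m = {p. length p = m \<and> set p \<subseteq> {step_u, step_d, step_h} \<and>
     (\<forall>j \<le> length p. 0 \<le> int k + snd (path_point p j)) \<and> int k + snd (path_end p) \<in> T}"

lemma path_point_0: "path_point p 0 = 0"
  by (simp add: path_point_def)

lemma path_point_Cons_Suc: "path_point (s # p) (Suc j) = s + path_point p j"
  by (simp add: path_point_def)

lemma path_end_Nil: "path_end [] = 0"
  by (simp add: path_end_def path_point_def)

lemma path_end_Cons: "path_end (s # p) = s + path_end p"
  by (simp add: path_end_def path_point_Cons_Suc)

lemma fst_path_end:
  "set p \<subseteq> {step_u, step_d, step_h} \<Longrightarrow> fst (path_end p) = int (length p)"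
  by (induction p) (auto simp: path_end_Nil path_end_Cons step_u_def step_d_def step_h_def)

lemma motzkin_paths_from_0: "motzkin_paths_from k T 0 = (if int k \<in> T then {[]} else {})"
  by (auto simp: motzkin_paths_from_def path_point_0 path_end_Nil)

lemma Cons_in_motzkin_paths_from:
  "s # p \<in> motzkin_paths_from k T (Suc m) \<longleftrightarrow>
     s \<in> {step_u, step_d, step_h} \<and> 0 \<le> int k + snd s \<and>
     p \<in> motzkin_paths_from (nat (int k + snd s)) T m"
proof -
  \<comment> \<open>The point reached after no step gives the condition on \<open>k\<close>, which always holds; the other
    points are those of \<open>p\<close>, shifted by \<open>s\<close>.\<close>
  have split: "(\<forall>j \<le> Suc i. P j) \<longleftrightarrow> P 0 \<and> (\<forall>j \<le> i. P (Suc j))" for P and i :: nat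
    by (metis Suc_le_mono le0 not0_implies_Suc)
  have "0 \<le> int k + snd s" if "\<forall>j \<le> length p. 0 \<le> int k + (snd s + snd (path_point p j))"
    using that[rule_format, of 0] by (simp add: path_point_0)
  then show ?thesis
    unfolding motzkin_paths_from_def mem_Collect_eq length_Cons split
    by (auto simp: path_point_0 path_point_Cons_Suc path_end_Cons add.assoc)
qed

lemma motzkin_paths_from_Suc:
  "motzkin_paths_from k T (Suc m) =
     (\<Union>s\<in>{s \<in> {step_u, step_d, step_h}. 0 \<le> int k + snd s}.
        Cons s ` motzkin_paths_from (nat (int k + snd s)) T m)"
proof -
  have "p \<in> motzkin_paths_from k T (Suc m) \<longleftrightarrow>
     (\<exists>s q. p = s # q \<and> s \<in> {step_u, step_d, step_h} \<and> 0 \<le> int k + snd s \<and>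
        q \<in> motzkin_paths_from (nat (int k + snd s)) T m)" for p
  proof (cases p)
    case Nil
    then show ?thesis by (simp add: motzkin_paths_from_def)
  next
    case (Cons s q)
    then show ?thesis by (simp add: Cons_in_motzkin_paths_from)
  qed
  then show ?thesis by blast
qed

lemma finite_motzkin_paths_from: "finite (motzkin_paths_from k T m)"
proof (induction m arbitrary: k)
  case 0
  show ?case by (simp add: motzkin_paths_from_0)
next
  case (Suc m)
  show ?case
    unfolding motzkin_paths_from_Suc by (rule card_UN_Cons(1)) (use Suc in auto)
qed

lemma card_motzkin_paths_from_Suc:
  "card (motzkin_paths_from k T (Suc m)) =
     card (motzkin_paths_from (Suc k) T m) + card (motzkin_paths_from k T m) +
     (if k = 0 then 0 else card (motzkin_paths_from (k - 1) T m))"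
proof -
  have steps: "{s \<in> {step_u, step_d, step_h}. 0 \<le> int k + snd s} =
      (if k = 0 then {step_u, step_h} else {step_u, step_h, step_d})"
    by (auto simp: step_u_def step_d_def step_h_def)
  have "card (motzkin_paths_from k T (Suc m)) =
      (\<Sum>s\<in>{s \<in> {step_u, step_d, step_h}. 0 \<le> int k + snd s}.
        card (motzkin_paths_from (nat (int k + snd s)) T m))"
    unfolding motzkin_paths_from_Suc
    by (rule card_UN_Cons(2)) (use finite_motzkin_paths_from in auto)
  then show ?thesis
    unfolding steps by (simp add: step_u_def step_d_def step_h_def nat_add_distrib nat_diff_distrib)
qed

lemma motzkin_number_eq: "motzkin_number n = card (motzkin_paths_from 0 {0} n)"
proof -
  have "{p \<in> nonneg_motzkin_paths. path_end p = (int n, 0)} = motzkin_paths_from 0 {0} n"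
    using fst_path_end
    by (fastforce simp: nonneg_motzkin_paths_def motzkin_paths_from_def prod_eq_iff)
  then show ?thesis by (simp add: motzkin_number_def)
qed

lemma motzkin_left_factor_number_eq:
  assumes "n \<ge> 1"
  shows "motzkin_left_factor_number n = card (motzkin_paths_from 0 UNIV (n - 1))"
proof -
  have "{p \<in> nonneg_motzkin_paths. fst (path_end p) = int n - 1} = motzkin_paths_from 0 UNIV (n - 1)"
    using fst_path_end assms
    by (fastforce simp: nonneg_motzkin_paths_def motzkin_paths_from_def)
  then show ?thesis by (simp add: motzkin_left_factor_number_def)
qed

section \<open>The pattern 2-31\<close>

definition slow_step :: "nat \<Rightarrow> nat \<Rightarrow> bool" where
  "slow_step a b \<longleftrightarrow> catalan_step a b \<and> a \<le> b + 1"

lemma slow_step_successors: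
  "{b. slow_step (Suc k) b} = (if k = 0 then {Suc (Suc k), Suc k} else {Suc (Suc k), Suc k, k})"
  by (auto simp: slow_step_def catalan_step_def)

lemma finite_slow_step_successors: "finite {b. slow_step a b}"
  by (rule finite_subset[of _ "{..a + 1}"]) (auto simp: slow_step_def catalan_step_def)

text \<open>The letter \<open>k + 1\<close> corresponds to height \<open>k\<close>, and both counts obey the same recursion.\<close>

lemma card_continuations_slow_step:
  "card (continuations slow_step (Suc k) m) = card (motzkin_paths_from k UNIV m)"
proof (induction m arbitrary: k)
  case 0
  show ?case by (simp add: continuations_0 motzkin_paths_from_0)
next
  case (Suc m)
  have pred: "card (continuations slow_step k m) = card (motzkin_paths_from (k - 1) UNIV m)"
    if "k \<noteq> 0" using Suc[of "k - 1"] that by simp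
  show ?case
    unfolding card_continuations_Suc[of slow_step, OF finite_slow_step_successors]
      slow_step_successors card_motzkin_paths_from_Suc
    using Suc pred by simp
qed

section \<open>The pattern 1-22\<close>

definition no_high_level_step :: "nat \<Rightarrow> nat \<Rightarrow> bool" where
  "no_high_level_step a b \<longleftrightarrow> catalan_step a b \<and> \<not> (a = b \<and> a > 1)"

lemma no_high_level_step_successors_1: "{b. no_high_level_step (Suc 0) b} = {Suc 0, Suc (Suc 0)}"
  by (auto simp: no_high_level_step_def catalan_step_def)

lemma no_high_level_step_successors:
  "{b. no_high_level_step (Suc (Suc k)) b} = insert (Suc (Suc (Suc k))) (Suc ` {..k})"
proof -
  have "b \<in> Suc ` {..k} \<longleftrightarrow> 1 \<le> b \<and> b \<le> Suc k" for b
    by (cases b) auto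
  then show ?thesis by (auto simp: no_high_level_step_def catalan_step_def)
qed

lemma finite_no_high_level_step_successors: "finite {b. no_high_level_step a b}"
  by (rule finite_subset[of _ "{..a + 1}"]) (auto simp: no_high_level_step_def catalan_step_def)

text \<open>The value is \<open>\<Sum>i\<le>k. (k choose i) * g (j + i)\<close>.  Taking Pascal's rule as the definition
  keeps binomial coefficients out of the proofs.\<close>

fun binomial_sum :: "(nat \<Rightarrow> nat) \<Rightarrow> nat \<Rightarrow> nat \<Rightarrow> nat" where
  "binomial_sum g 0 j = g j"
| "binomial_sum g (Suc k) j = binomial_sum g k j + binomial_sum g k (Suc j)"

text \<open>Summing over all lower heights in the recursion for words produces the right-hand side.\<close>

lemma binomial_sum_0_telescope:
  "binomial_sum g k 0 = g 0 + (\<Sum>i<k. binomial_sum g i (Suc 0))"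
  by (induction k) auto

text \<open>The hypothesis is restricted to positive arguments because a path at height \<open>0\<close> cannot
  descend; hence the conclusion concerns sums that start at a positive height.\<close>

lemma binomial_sum_Motzkin_recurrence:
  assumes "\<And>j. g' (Suc j) = g j + g (Suc j) + g (Suc (Suc j))"
  shows "binomial_sum g' k (Suc j) =
    binomial_sum g k j + binomial_sum g k (Suc j) + binomial_sum g k (Suc (Suc j))"
  using assms by (induction k arbitrary: j) auto

lemma binomial_sum_indicator:
  assumes "\<And>j. g (Suc j) = (if j = 0 then 1 else 0)"
  shows "binomial_sum g k (Suc j) = (if j = 0 then 1 else 0)"
  using assms by (induction k arbitrary: j) auto

definition paths_to_axis :: "nat \<Rightarrow> nat \<Rightarrow> nat" where
  "paths_to_axis m k = card (motzkin_paths_from k {0} m)"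

lemma paths_to_axis_0: "paths_to_axis 0 k = (if k = 0 then 1 else 0)"
  by (simp add: paths_to_axis_def motzkin_paths_from_0)

lemma paths_to_axis_Suc_0:
  "paths_to_axis (Suc m) 0 = paths_to_axis m 0 + paths_to_axis m (Suc 0)"
  by (simp add: paths_to_axis_def card_motzkin_paths_from_Suc)

lemma paths_to_axis_Suc_Suc:
  "paths_to_axis (Suc m) (Suc k) =
     paths_to_axis m k + paths_to_axis m (Suc k) + paths_to_axis m (Suc (Suc k))"
  by (simp add: paths_to_axis_def card_motzkin_paths_from_Suc)

text \<open>The first conjunct is the one of interest.  Its induction step needs the second one, since
  the letter \<open>1\<close> may be followed by \<open>2\<close>.  The number of path steps exceeds the number of
  letters still to be written by one because a word of length \<open>n\<close> has only \<open>n - 1\<close> letters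
  after its initial one, while the corresponding path has \<open>n\<close> steps.\<close>

lemma card_continuations_no_high_level_step:
  "card (continuations no_high_level_step (Suc 0) m) = paths_to_axis (Suc m) 0 \<and>
   card (continuations no_high_level_step (Suc (Suc k)) m) =
     binomial_sum (paths_to_axis (Suc m)) k (Suc 0)"
proof (induction m arbitrary: k)
  case 0
  show ?case
    by (simp add: continuations_0 paths_to_axis_Suc_0 paths_to_axis_Suc_Suc paths_to_axis_0
        binomial_sum_indicator)
next
  case (Suc m)
  let ?f = "\<lambda>a. card (continuations no_high_level_step a m)"
  let ?g = "paths_to_axis (Suc m)"
  note step = card_continuations_Suc[of no_high_level_step, OF finite_no_high_level_step_successors]
  have "card (continuations no_high_level_step (Suc 0) (Suc m)) = ?g 0 + ?g (Suc 0)"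
    using Suc[of 0] by (simp add: step no_high_level_step_successors_1)
  moreover have "card (continuations no_high_level_step (Suc (Suc k)) (Suc m)) =
      binomial_sum (paths_to_axis (Suc (Suc m))) k (Suc 0)"
  proof -
    \<comment> \<open>The letter \<open>k + 2\<close> may be followed by \<open>k + 3\<close> or by any of \<open>1, \<dots>, k + 1\<close>.  The latter,
      the letter \<open>1\<close> being treated apart, account for the missing down-term \<open>binomial_sum ?g k 0\<close>
      of the three-term recurrence.\<close>
    have "(\<Sum>b\<in>Suc ` {..k}. ?f b) = (\<Sum>i<Suc k. ?f (Suc i))"
      by (simp add: sum.reindex lessThan_Suc_atMost)
    also have "\<dots> = ?f (Suc 0) + (\<Sum>i<k. ?f (Suc (Suc i)))"
      by (rule sum.lessThan_Suc_shift)
    also have "\<dots> = binomial_sum ?g k 0"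
      using Suc by (simp add: binomial_sum_0_telescope)
    finally have below: "(\<Sum>b\<in>Suc ` {..k}. ?f b) = binomial_sum ?g k 0" .
    have "card (continuations no_high_level_step (Suc (Suc k)) (Suc m)) =
        ?f (Suc (Suc (Suc k))) + (\<Sum>b\<in>Suc ` {..k}. ?f b)"
      unfolding step no_high_level_step_successors by (rule sum.insert) auto
    also have "\<dots> = binomial_sum ?g (Suc k) (Suc 0) + binomial_sum ?g k 0"
      using Suc[of "Suc k"] below by simp
    also have "\<dots> = binomial_sum (paths_to_axis (Suc (Suc m))) k (Suc 0)"
      using binomial_sum_Motzkin_recurrence[of "paths_to_axis (Suc (Suc m))" ?g]
      by (simp add: paths_to_axis_Suc_Suc)
    finally show ?thesis .
  qed
  ultimately show ?case
    using paths_to_axis_Suc_0[of "Suc m"] by simp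
qed

theorem theorem2p2:
  fixes n :: nat
  assumes "n \<ge> 1"
  shows "catalan_avoiders n (1, 2, 2) = motzkin_number n \<and>
         catalan_avoiders n (2, 3, 1) = motzkin_left_factor_number n"
proof
  have "catalan_avoiders n (1, 2, 2) = card (continuations no_high_level_step 1 (n - 1))"
    unfolding no_high_level_step_def
    by (rule catalan_avoiders_eq_card_continuations[OF assms]) (use contains_122_iff in blast)
  also have "\<dots> = paths_to_axis n 0"
    using assms card_continuations_no_high_level_step[of "n - 1"] by simp
  finally show "catalan_avoiders n (1, 2, 2) = motzkin_number n"
    by (simp add: motzkin_number_eq paths_to_axis_def)
next
  have "catalan_avoiders n (2, 3, 1) = card (continuations slow_step 1 (n - 1))"
    unfolding slow_step_def
    by (rule catalan_avoiders_eq_card_continuations[OF assms])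
      (metis contains_231_iff not_less)
  then show "catalan_avoiders n (2, 3, 1) = motzkin_left_factor_number n"
    using card_continuations_slow_step[of 0 "n - 1"] motzkin_left_factor_number_eq[OF assms]
    by simp
qed

end
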